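(* Let $d$ be a positive integer. Let $G$ be the union of the graphs $G_1=(V_1,E_1)$ and $G_2=(V_2,E_2)$ with $|V_1\cap V_2|\le d+1$, and let $u,v\in V_1\cap V_2$ be a pair of vertices. If $\{u,v\}$ is $\mathcal{R}_d$-linked in both $G_1$ and $G_2$, then $\{u,v\}$ is $d$-stress-linked in $G$.
   Context: Graphs are finite and simple, with a nonempty edge set; a pair of vertices consists of two distinct vertices. The union of $G_1,G_2$ is $(V_1\cup V_2,E_1\cup E_2)$. $G+uv$ is $G$ with the edge $uv$ added ($G+uv=G$ if $uv\in E(G)$). Let $G=(V,E)$. A realization (framework) of $G$ in $\mathbb{C}^d$ is a pair $(G,p)$ with $p:V\to\mathbb{C}^d$. It is generic if the $d|V|$ coordinates of $p$ do not satisfy any nonzero polynomial with rational coefficients. Put $m_{uv}(p)=\sum_{i=1}^d(p(u)_i-p(v)_i)^2$ and $m_{d,G}(p)=(m_{uv}(p))_{uv\in E}\in\mathbb{C}^E$. The generic rigidity matroid $\mathcal{R}_d(G)$ is the matroid on $E$ given by the rows of the Jacobian matrix of $m_{d,G}$ at any generic configuration $p$ (the result does not depend on $p$); $r_d(G)$ is its rank. A pair $\{u,v\}$ is $\mathcal{R}_d$-linked in $G$ if $r_d(G+uv)=r_d(G)$. A stress of $(G,p)$ is a vector $\omega\in\mathbb{C}^E$ with $\sum_{u:uv\in E}\omega_{uv}(p(u)-p(v))=0$ for every $v\in V$; $S(G,p)$ is the linear space of stresses. Set $K_1(G,p)=\{q\in\mathbb{C}^V: S(G,p)\subseteq S(G,q)\}$,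 where $q$ is viewed as a one-dimensional realization; this is a linear space. Its dimension is the same for every generic $(G,p)$ in $\mathbb{C}^d$; this number is denoted $k_{d,G}$. A pair $\{u,v\}$ is $d$-stress-linked in $G$ if $\{u,v\}$ is $\mathcal{R}_d$-linked in $G$ and $k_{d,G+uv}=k_{d,G}$. *)

theory Defs
  imports "HOL-Analysis.Derivative" "HOL-Library.Function_Algebras" "HOL-Library.Poly_Mapping"
begin

type_synonym 'a ugraph = "'a set \<times> 'a set set"

abbreviation verts :: "'a ugraph \<Rightarrow> 'a set" where "verts G \<equiv> fst G"
abbreviation edges :: "'a ugraph \<Rightarrow> 'a set set" where "edges G \<equiv> snd G"

definition simple_graph :: "'a ugraph \<Rightarrow> bool" where
  "simple_graph G \<longleftrightarrow> finite (verts G) \<and> edges G \<noteq> {} \<and>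
     (\<forall>e\<in>edges G. e \<subseteq> verts G \<and> card e = 2)"

definition graph_union :: "'a ugraph \<Rightarrow> 'a ugraph \<Rightarrow> 'a ugraph" where
  "graph_union G H = (verts G \<union> verts H, edges G \<union> edges H)"

definition add_edge :: "'a ugraph \<Rightarrow> 'a \<Rightarrow> 'a \<Rightarrow> 'a ugraph" where
  "add_edge G u v = (verts G, insert {u, v} (edges G))"


text \<open>
  Coordinate spaces \<open>\<complex>\<^sup>I\<close> are rendered as functions into the complex numbers that vanish outside
  the index set \<open>I\<close>; linear independence and dimension are taken in the full function space.
\<close>

definition fun_scale :: "complex \<Rightarrow> ('b \<Rightarrow> complex) \<Rightarrow> 'b \<Rightarrow> complex" where
  "fun_scale c f = (\<lambda>x. c * f x)"

global_interpretation cfun: vector_space fun_scale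
  by unfold_locales (auto simp: fun_scale_def fun_eq_iff algebra_simps)


text \<open>
  A configuration in dimension \<open>d\<close> is a function \<open>p :: 'a \<Rightarrow> nat \<Rightarrow> complex\<close>, of which only the
  coordinates \<open>p x i\<close> with \<open>x\<close> a vertex and \<open>i < d\<close> matter.  Multivariate polynomials over the
  rationals with variables in \<open>'x\<close> are finitely supported maps from monomials to coefficients.
\<close>

definition eval_poly ::
    "(('x \<Rightarrow>\<^sub>0 nat) \<Rightarrow>\<^sub>0 rat) \<Rightarrow> ('x \<Rightarrow> complex) \<Rightarrow> complex" where
  "eval_poly P z =
     (\<Sum>m\<in>Poly_Mapping.keys P. of_rat (Poly_Mapping.lookup P m) *
        (\<Prod>x\<in>Poly_Mapping.keys m. z x ^ Poly_Mapping.lookup m x))"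

definition generic :: "nat \<Rightarrow> 'a set \<Rightarrow> ('a \<Rightarrow> nat \<Rightarrow> complex) \<Rightarrow> bool" where
  "generic d V p \<longleftrightarrow>
     (\<forall>P :: ('a \<times> nat \<Rightarrow>\<^sub>0 nat) \<Rightarrow>\<^sub>0 rat.
        P \<noteq> 0 \<and> (\<forall>m\<in>Poly_Mapping.keys P. Poly_Mapping.keys m \<subseteq> V \<times> {..<d}) \<longrightarrow>
        eval_poly P (\<lambda>(x, i). p x i) \<noteq> 0)"

text \<open>
  The generic invariants below do not depend on the generic configuration at which they are
  evaluated, so they are defined by means of a chosen one.
\<close>

definition generic_config :: "nat \<Rightarrow> 'a set \<Rightarrow> 'a \<Rightarrow> nat \<Rightarrow> complex" where
  "generic_config d V = (SOME p. generic d V p)"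


text \<open>
  The component of the measurement map at an edge.  The value is well defined because the
  expression is symmetric in the two end vertices.
\<close>

definition edge_measure :: "nat \<Rightarrow> ('a \<Rightarrow> nat \<Rightarrow> complex) \<Rightarrow> 'a set \<Rightarrow> complex" where
  "edge_measure d p e = (THE s. \<exists>u v. e = {u, v} \<and> s = (\<Sum>i<d. (p u i - p v i)\<^sup>2))"

lemma edge_measure_doubleton: "edge_measure d p {u, v} = (\<Sum>i<d. (p u i - p v i)\<^sup>2)"
  unfolding edge_measure_def
  by (rule the_equality) (auto simp: doubleton_eq_iff power2_commute)

definition jacobian_row ::
    "nat \<Rightarrow> 'a ugraph \<Rightarrow> ('a \<Rightarrow> nat \<Rightarrow> complex) \<Rightarrow> 'a set \<Rightarrow> 'a \<times> nat \<Rightarrow> complex" where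
  "jacobian_row d G p e = (\<lambda>(x, i).
     if x \<in> verts G \<and> i < d
     then deriv (\<lambda>z. edge_measure d (p(x := (p x)(i := z))) e) (p x i)
     else 0)"

text \<open>Injectivity is needed because matroid independence concerns the indexed family of rows.\<close>

definition rigidity_indep :: "nat \<Rightarrow> 'a ugraph \<Rightarrow> 'a set set \<Rightarrow> bool" where
  "rigidity_indep d G F \<longleftrightarrow> F \<subseteq> edges G \<and>
     (let row = jacobian_row d G (generic_config d (verts G))
      in inj_on row F \<and> cfun.independent (row ` F))"

definition rigidity_rank :: "nat \<Rightarrow> 'a ugraph \<Rightarrow> nat" where
  "rigidity_rank d G = Max (card ` {F. rigidity_indep d G F})"

definition rigidity_linked :: "nat \<Rightarrow> 'a ugraph \<Rightarrow> 'a \<Rightarrow> 'a \<Rightarrow> bool" where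
  "rigidity_linked d G u v \<longleftrightarrow> rigidity_rank d (add_edge G u v) = rigidity_rank d G"


definition stresses ::
    "nat \<Rightarrow> 'a ugraph \<Rightarrow> ('a \<Rightarrow> nat \<Rightarrow> complex) \<Rightarrow> ('a set \<Rightarrow> complex) set" where
  "stresses d G p = {\<omega>. (\<forall>e. e \<notin> edges G \<longrightarrow> \<omega> e = 0) \<and>
     (\<forall>v\<in>verts G. \<forall>i<d. (\<Sum>u | {u, v} \<in> edges G. \<omega> {u, v} * (p u i - p v i)) = 0)}"

definition stress_kernel ::
    "nat \<Rightarrow> 'a ugraph \<Rightarrow> ('a \<Rightarrow> nat \<Rightarrow> complex) \<Rightarrow> ('a \<Rightarrow> complex) set" where
  "stress_kernel d G p = {q. (\<forall>x. x \<notin> verts G \<longrightarrow> q x = 0) \<and>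
     stresses d G p \<subseteq> stresses 1 G (\<lambda>x _. q x)}"

definition stress_kernel_dim :: "nat \<Rightarrow> 'a ugraph \<Rightarrow> nat" where
  "stress_kernel_dim d G = cfun.dim (stress_kernel d G (generic_config d (verts G)))"

definition stress_linked :: "nat \<Rightarrow> 'a ugraph \<Rightarrow> 'a \<Rightarrow> 'a \<Rightarrow> bool" where
  "stress_linked d G u v \<longleftrightarrow> rigidity_linked d G u v \<and>
     stress_kernel_dim d (add_edge G u v) = stress_kernel_dim d G"

end

theory Submission
  imports Defs "HOL-Analysis.Continuum_Not_Denumerable" "HOL-Computational_Algebra.Polynomial"
begin

text \<open>
  Suppose that \<open>uv\<close> is not an edge of the union, since otherwise nothing is added. Let \<open>p\<close> be a
  generic configuration of the union. Linkedness in \<open>G\<^sub>i\<close> gives a stress \<open>\<omega>\<^sub>i\<close> of \<open>G\<^sub>i + uv\<close> at \<open>p\<close> with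
  coefficient \<open>1\<close> at \<open>uv\<close>. Either one shows that \<open>uv\<close> is linked in the union, and together with the
  stresses of the union \<open>\<omega>\<^sub>1\<close> spans the stresses of the union plus \<open>uv\<close>. So it has to be shown that
  \<open>\<omega>\<^sub>1\<close> is a stress of every one-dimensional configuration \<open>q\<close> in the stress kernel of the union.

  Read a stress as the weights of a graph Laplacian, a symmetric matrix that annihilates the
  constant vector and the \<open>d\<close> coordinate vectors of \<open>p\<close>. Since \<open>\<omega>\<^sub>1 - \<omega>\<^sub>2\<close> is a stress of the union, the
  Laplacians of \<open>\<omega>\<^sub>1\<close> and \<open>\<omega>\<^sub>2\<close> map \<open>q\<close> to the same vector \<open>b\<close>. The first vanishes outside \<open>V\<^sub>1\<close> and the
  second outside \<open>V\<^sub>2\<close>, so \<open>b\<close> lives on \<open>V\<^sub>1 \<inter> V\<^sub>2\<close>; by symmetry it is orthogonal to the constants and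
  to the coordinates of \<open>p\<close>. Thus \<open>b\<close> is an affine dependence of at most \<open>d + 1\<close> generic points of
  \<open>\<complex>\<^sup>d\<close>, and such points are affinely independent; so \<open>b = 0\<close>
  (\<open>generic_affinely_independent\<close>, \<open>laplacian_kernel_eq_0\<close>).

  Two facts about genericity support this. Generic configurations exist
  (\<open>generic_generic_config\<close>), because countably many polynomial conditions cannot exhaust the
  complex numbers. And a matrix of rational polynomials whose rows are independent at some point has
  independent rows at every generic point (\<open>generic_independent_family\<close>); this moves linkedness from
  the configurations chosen for \<open>G\<^sub>1\<close> and \<open>G\<^sub>2\<close> to the restrictions of \<open>p\<close>
  (\<open>linked_imp_stress\<close>), and it also yields the affine independence.
\<close>

section \<open>Polynomial functions and generic points\<close>

abbreviation monomial_value :: "('x \<Rightarrow>\<^sub>0 nat) \<Rightarrow> ('x \<Rightarrow> complex) \<Rightarrow> complex" where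
  "monomial_value m z \<equiv> (\<Prod>x\<in>Poly_Mapping.keys m. z x ^ Poly_Mapping.lookup m x)"

lemma monomial_value_superset:
  assumes "finite X" "Poly_Mapping.keys m \<subseteq> X"
  shows "monomial_value m z = (\<Prod>x\<in>X. z x ^ Poly_Mapping.lookup m x)"
  by (rule prod.mono_neutral_left) (use assms in \<open>auto simp: in_keys_iff\<close>)

lemma monomial_value_add: "monomial_value (m + n) z = monomial_value m z * monomial_value n z"
proof -
  let ?X = "Poly_Mapping.keys m \<union> Poly_Mapping.keys n"
  have "monomial_value (m + n) z = (\<Prod>x\<in>?X. z x ^ Poly_Mapping.lookup (m + n) x)"
    by (rule monomial_value_superset) (auto simp: keys_add)
  also have "\<dots> = monomial_value m z * monomial_value n z"
    by (subst (1 2) monomial_value_superset[of ?X])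
       (auto simp: lookup_add power_add prod.distrib)
  finally show ?thesis .
qed

lemma eval_poly_superset:
  assumes "finite A" "Poly_Mapping.keys P \<subseteq> A"
  shows "eval_poly P z = (\<Sum>m\<in>A. of_rat (Poly_Mapping.lookup P m) * monomial_value m z)"
  unfolding eval_poly_def
  by (rule sum.mono_neutral_left) (use assms in \<open>auto simp: in_keys_iff\<close>)

lemma eval_poly_single: "eval_poly (Poly_Mapping.single m c) z = of_rat c * monomial_value m z"
  by (subst eval_poly_superset[of "{m}"]) auto

lemma eval_poly_add: "eval_poly (P + Q) z = eval_poly P z + eval_poly Q z"
proof -
  let ?A = "Poly_Mapping.keys P \<union> Poly_Mapping.keys Q"
  have "eval_poly (P + Q) z = (\<Sum>m\<in>?A. of_rat (Poly_Mapping.lookup (P + Q) m) * monomial_value m z)"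
    by (rule eval_poly_superset) (use keys_add[of P Q] in auto)
  also have "\<dots> = eval_poly P z + eval_poly Q z"
    by (subst (1 2) eval_poly_superset[of ?A])
       (auto simp: lookup_add of_rat_add algebra_simps sum.distrib)
  finally show ?thesis .
qed

lemma eval_poly_sum: "eval_poly (sum f A) z = (\<Sum>a\<in>A. eval_poly (f a) z)"
  by (induction A rule: infinite_finite_induct) (simp_all add: eval_poly_add eval_poly_superset[of "{}" 0])

lemma poly_mapping_eq_sum_single:
  "P = (\<Sum>m\<in>Poly_Mapping.keys P. Poly_Mapping.single m (Poly_Mapping.lookup P m))"
  by (rule poly_mapping_eqI)
     (auto simp: lookup_sum lookup_single when_def in_keys_iff)

lemma eval_poly_mult: "eval_poly (P * Q) z = eval_poly P z * eval_poly Q z"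
proof -
  let ?s = "\<lambda>P m. Poly_Mapping.single m (Poly_Mapping.lookup P m)"
  have "P * Q = (\<Sum>m\<in>Poly_Mapping.keys P. ?s P m) * (\<Sum>n\<in>Poly_Mapping.keys Q. ?s Q n)"
    by (subst poly_mapping_eq_sum_single[of P], subst poly_mapping_eq_sum_single[of Q]) (rule refl)
  also have "\<dots> = (\<Sum>m\<in>Poly_Mapping.keys P. \<Sum>n\<in>Poly_Mapping.keys Q.
      Poly_Mapping.single (m + n) (Poly_Mapping.lookup P m * Poly_Mapping.lookup Q n))"
    by (simp add: sum_product mult_single)
  finally have "eval_poly (P * Q) z = (\<Sum>m\<in>Poly_Mapping.keys P. \<Sum>n\<in>Poly_Mapping.keys Q.
      of_rat (Poly_Mapping.lookup P m * Poly_Mapping.lookup Q n) * monomial_value (m + n) z)"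
    by (simp add: eval_poly_sum eval_poly_single)
  also have "\<dots> = eval_poly P z * eval_poly Q z"
    unfolding eval_poly_def sum_product
    by (simp add: monomial_value_add of_rat_mult mult_ac)
  finally show ?thesis .
qed

definition rational_polynomials :: "'x set \<Rightarrow> (('x \<Rightarrow> complex) \<Rightarrow> complex) set" where
  "rational_polynomials X =
     {eval_poly P |P. \<forall>m\<in>Poly_Mapping.keys P. Poly_Mapping.keys m \<subseteq> X}"

lemma rational_polynomials_monomial:
  assumes "Poly_Mapping.keys m \<subseteq> X"
  shows "(\<lambda>z. of_rat c * monomial_value m z) \<in> rational_polynomials X"
  unfolding rational_polynomials_def
  by (rule CollectI, rule exI[of _ "Poly_Mapping.single m c"])
     (use assms in \<open>auto simp: eval_poly_single fun_eq_iff\<close>)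

lemma rational_polynomials_const: "(\<lambda>z. of_rat c) \<in> rational_polynomials X"
  using rational_polynomials_monomial[of 0 X c] by simp

lemma rational_polynomials_var: "x \<in> X \<Longrightarrow> (\<lambda>z. z x) \<in> rational_polynomials X"
  using rational_polynomials_monomial[of "Poly_Mapping.single x 1" X 1] by simp

lemma rational_polynomials_add:
  assumes "f \<in> rational_polynomials X" "g \<in> rational_polynomials X"
  shows "(\<lambda>z. f z + g z) \<in> rational_polynomials X"
proof -
  obtain P Q where PQ: "f = eval_poly P" "g = eval_poly Q"
    "\<forall>m\<in>Poly_Mapping.keys P. Poly_Mapping.keys m \<subseteq> X"
    "\<forall>m\<in>Poly_Mapping.keys Q. Poly_Mapping.keys m \<subseteq> X"
    using assms by (auto simp: rational_polynomials_def)
  have "Poly_Mapping.keys m \<subseteq> X" if "m \<in> Poly_Mapping.keys (P + Q)" for m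
    using subsetD[OF keys_add that] PQ(3,4) by auto
  then show ?thesis
    unfolding rational_polynomials_def
    by (intro CollectI exI[of _ "P + Q"]) (simp add: PQ(1,2) eval_poly_add fun_eq_iff)
qed

lemma rational_polynomials_mult:
  assumes "f \<in> rational_polynomials X" "g \<in> rational_polynomials X"
  shows "(\<lambda>z. f z * g z) \<in> rational_polynomials X"
proof -
  obtain P Q where PQ: "f = eval_poly P" "g = eval_poly Q"
    "\<forall>m\<in>Poly_Mapping.keys P. Poly_Mapping.keys m \<subseteq> X"
    "\<forall>m\<in>Poly_Mapping.keys Q. Poly_Mapping.keys m \<subseteq> X"
    using assms by (auto simp: rational_polynomials_def)
  have "Poly_Mapping.keys m \<subseteq> X" if m: "m \<in> Poly_Mapping.keys (P * Q)" for m
  proof -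
    obtain a b where "m = a + b" "a \<in> Poly_Mapping.keys P" "b \<in> Poly_Mapping.keys Q"
      using subsetD[OF keys_mult m] by auto
    then show ?thesis using PQ(3,4) keys_add[of a b] by blast
  qed
  then show ?thesis
    unfolding rational_polynomials_def
    by (intro CollectI exI[of _ "P * Q"]) (auto simp: PQ(1,2) eval_poly_mult fun_eq_iff)
qed

lemma rational_polynomials_diff:
  assumes "f \<in> rational_polynomials X" "g \<in> rational_polynomials X"
  shows "(\<lambda>z. f z - g z) \<in> rational_polynomials X"
  using rational_polynomials_add[OF assms(1)
      rational_polynomials_mult[OF rational_polynomials_const[of "-1"] assms(2)]]
  by (simp add: of_rat_minus)

text \<open>
  The working form of genericity: a nonzero value at an arbitrary point \<open>z\<close> certifies that the
  polynomial is nonzero, hence that it does not vanish at \<open>p\<close>.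
\<close>

lemma generic_nonzero:
  assumes "generic d V p" "f \<in> rational_polynomials (V \<times> {..<d})" "f z \<noteq> 0"
  shows "f (case_prod p) \<noteq> 0"
proof -
  obtain P where P: "f = eval_poly P" "\<forall>m\<in>Poly_Mapping.keys P. Poly_Mapping.keys m \<subseteq> V \<times> {..<d}"
    using assms(2) by (auto simp: rational_polynomials_def)
  with assms(3) have "P \<noteq> 0" by (auto simp: eval_poly_def)
  with P assms(1) show ?thesis by (auto simp: generic_def)
qed

lemma generic_subset: "generic d V p \<Longrightarrow> W \<subseteq> V \<Longrightarrow> generic d W p"
  unfolding generic_def by (meson Sigma_mono order_refl subset_trans)

text \<open>
  A finitely supported map is determined by its finite graph.
\<close>

lemma countable_poly_mappings:
  fixes A :: "'b set"
  assumes "countable A"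
  shows "countable {f :: 'b \<Rightarrow>\<^sub>0 'c :: {zero,countable}. Poly_Mapping.keys f \<subseteq> A}" (is "countable ?S")
proof -
  define graph where
    "graph = (\<lambda>f :: 'b \<Rightarrow>\<^sub>0 'c. (\<lambda>x. (x, Poly_Mapping.lookup f x)) ` Poly_Mapping.keys f)"
  have "inj_on graph ?S"
  proof (rule inj_onI, rule poly_mapping_eqI)
    fix f g :: "'b \<Rightarrow>\<^sub>0 'c" and x assume *: "graph f = graph g"
    show "Poly_Mapping.lookup f x = Poly_Mapping.lookup g x"
    proof (cases "x \<in> Poly_Mapping.keys f \<or> x \<in> Poly_Mapping.keys g")
      case True
      then have "(x, Poly_Mapping.lookup f x) \<in> graph f \<or> (x, Poly_Mapping.lookup g x) \<in> graph g"
        by (auto simp: graph_def)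
      then have "(x, Poly_Mapping.lookup f x) \<in> graph g \<or> (x, Poly_Mapping.lookup g x) \<in> graph f"
        by (simp add: *)
      then show ?thesis by (auto simp: graph_def)
    next
      case False
      then show ?thesis by (simp add: in_keys_iff)
    qed
  qed
  moreover have "graph ` ?S \<subseteq> {B. B \<subseteq> A \<times> UNIV \<and> finite B}"
    by (auto simp: graph_def)
  moreover have "countable {B. B \<subseteq> A \<times> (UNIV :: 'c set) \<and> finite B}"
    using countable_Collect_finite_subset[of "A \<times> (UNIV :: 'c set)"] assms
    by (simp add: conj_commute)
  ultimately show ?thesis
    by (meson countable_image_inj_on countable_subset)
qed

lemma countable_rational_polynomials:
  assumes "finite X"
  shows "countable {P :: ('x \<Rightarrow>\<^sub>0 nat) \<Rightarrow>\<^sub>0 rat. \<forall>m\<in>Poly_Mapping.keys P. Poly_Mapping.keys m \<subseteq> X}"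
  using countable_poly_mappings[OF countable_poly_mappings[OF countable_finite[OF assms], where ?'c = nat],
      where ?'c = rat]
  by (simp add: subset_iff Ball_def)

text \<open>
  The leading coefficient of \<open>P\<close> in the variable \<open>y\<close> is a nonzero polynomial in the remaining
  variables, so it does not vanish at a point \<open>z\<close> that is generic for these; hence \<open>P\<close> becomes a
  nonzero polynomial in one variable when the others are fixed at \<open>z\<close>.
\<close>

lemma finite_bad_values:
  fixes P :: "('x \<Rightarrow>\<^sub>0 nat) \<Rightarrow>\<^sub>0 rat"
  assumes "finite X" "y \<notin> X" "P \<noteq> 0"
    and keys: "\<forall>m\<in>Poly_Mapping.keys P. Poly_Mapping.keys m \<subseteq> insert y X"
    and z: "\<And>Q. Q \<noteq> 0 \<Longrightarrow> \<forall>m\<in>Poly_Mapping.keys Q. Poly_Mapping.keys m \<subseteq> X \<Longrightarrow> eval_poly Q z \<noteq> 0"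
  shows "finite {t. eval_poly P (z(y := t)) = 0}"
proof -
  define deg where "deg = (\<lambda>m :: 'x \<Rightarrow>\<^sub>0 nat. Poly_Mapping.lookup m y)"
  define K where "K = Max (deg ` Poly_Mapping.keys P)"
  have deg_le: "deg m \<le> K" if "m \<in> Poly_Mapping.keys P" for m
    using that by (auto simp: K_def)
  have "Poly_Mapping.keys P \<noteq> {}" using \<open>P \<noteq> 0\<close> poly_mapping_eq_sum_single[of P] by force
  then have "K \<in> deg ` Poly_Mapping.keys P" unfolding K_def by (intro Max_in) auto
  then obtain m0 where m0: "m0 \<in> Poly_Mapping.keys P" "deg m0 = K" by auto
  define shift where "shift = (\<lambda>m. m + Poly_Mapping.single y K)"
  have inj: "inj shift" by (auto simp: shift_def inj_def)
  have surj: "\<exists>m'. m = shift m'" if "deg m = K" for m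
    by (rule exI[of _ "m - Poly_Mapping.single y K"], rule poly_mapping_eqI)
       (use that in \<open>auto simp: shift_def lookup_add lookup_minus lookup_single when_def deg_def\<close>)
  define L where "L = Poly_Mapping.map_key shift P"
  have lookup_L: "Poly_Mapping.lookup L m = Poly_Mapping.lookup P (shift m)" for m
    unfolding L_def using inj by (simp add: map_key.rep_eq)
  have keys_L: "Poly_Mapping.keys m \<subseteq> X" if "m \<in> Poly_Mapping.keys L" for m
  proof
    fix x assume x: "x \<in> Poly_Mapping.keys m"
    have m: "shift m \<in> Poly_Mapping.keys P" using that by (simp add: in_keys_iff lookup_L)
    have "x \<in> Poly_Mapping.keys (shift m)"
      using x by (auto simp: in_keys_iff shift_def lookup_add)
    then have "x \<in> insert y X" using m keys by auto
    moreover have "x \<noteq> y"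
      using deg_le[OF m] x by (auto simp: shift_def deg_def lookup_add in_keys_iff)
    ultimately show "x \<in> X" by auto
  qed
  \<comment> \<open>Since \<open>K\<close> is maximal, \<open>L\<close> is the leading coefficient and does not contain \<open>y\<close>.\<close>
  obtain n0 where "m0 = shift n0" using surj m0 by blast
  then have "Poly_Mapping.lookup L n0 \<noteq> 0" using m0 by (auto simp: lookup_L in_keys_iff)
  then have "L \<noteq> 0" by auto
  then have eval_L: "eval_poly L z \<noteq> 0" using z keys_L by blast
  define restr where "restr = (\<lambda>m. \<Prod>x\<in>X. z x ^ Poly_Mapping.lookup m x)"
  define p where "p = (\<Sum>m\<in>Poly_Mapping.keys P.
      monom (of_rat (Poly_Mapping.lookup P m) * restr m) (deg m))"
  have "eval_poly P (z(y := t)) = poly p t" for t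
  proof -
    have "monomial_value m (z(y := t)) = t ^ deg m * restr m" if "m \<in> Poly_Mapping.keys P" for m
    proof -
      have "(\<Prod>x\<in>X. (z(y := t)) x ^ Poly_Mapping.lookup m x) = restr m"
        unfolding restr_def by (rule prod.cong) (use assms(2) in auto)
      then show ?thesis
        using monomial_value_superset[of "insert y X" m "z(y := t)"] assms(1,2) keys that
        by (simp add: deg_def)
    qed
    then show ?thesis
      unfolding eval_poly_def p_def poly_sum poly_monom
      by (intro sum.cong) (auto simp: mult_ac)
  qed
  moreover have "coeff p K = eval_poly L z"
  proof -
    have "coeff p K = (\<Sum>m\<in>Poly_Mapping.keys P.
        if deg m = K then of_rat (Poly_Mapping.lookup P m) * restr m else 0)"
      by (simp add: p_def coeff_sum)
    also have "\<dots> = (\<Sum>m\<in>{m \<in> Poly_Mapping.keys P. deg m = K}.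
        of_rat (Poly_Mapping.lookup P m) * restr m)"
      by (simp add: sum.inter_filter)
    also have "{m \<in> Poly_Mapping.keys P. deg m = K} = shift ` Poly_Mapping.keys L"
    proof (intro equalityI subsetI)
      fix m assume "m \<in> {m \<in> Poly_Mapping.keys P. deg m = K}"
      then show "m \<in> shift ` Poly_Mapping.keys L"
        using surj[of m] by (auto simp: in_keys_iff lookup_L)
    next
      fix m assume "m \<in> shift ` Poly_Mapping.keys L"
      then obtain n where n: "m = shift n" "n \<in> Poly_Mapping.keys L" by auto
      then have m: "m \<in> Poly_Mapping.keys P" by (auto simp: in_keys_iff lookup_L)
      with n deg_le[OF m] show "m \<in> {m \<in> Poly_Mapping.keys P. deg m = K}"
        by (auto simp: deg_def shift_def lookup_add)
    qed
    also have "(\<Sum>m\<in>shift ` Poly_Mapping.keys L. of_rat (Poly_Mapping.lookup P m) * restr m) =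
        (\<Sum>m\<in>Poly_Mapping.keys L. of_rat (Poly_Mapping.lookup L m) * restr (shift m))"
      using inj by (subst sum.reindex) (auto simp: lookup_L inj_on_def inj_def)
    also have "\<dots> = eval_poly L z"
      unfolding eval_poly_def
    proof (rule sum.cong)
      fix m assume m: "m \<in> Poly_Mapping.keys L"
      have "restr (shift m) = restr m"
        unfolding restr_def
        by (rule prod.cong)
           (use assms(2) in \<open>auto simp: shift_def lookup_add lookup_single when_def\<close>)
      also have "\<dots> = monomial_value m z"
        unfolding restr_def using monomial_value_superset[OF assms(1) keys_L[OF m]] by simp
      finally show "of_rat (Poly_Mapping.lookup L m) * restr (shift m) =
          of_rat (Poly_Mapping.lookup L m) * monomial_value m z" by simp
    qed simp
    finally show ?thesis .
  qed
  with eval_L have "p \<noteq> 0" by auto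
  ultimately show ?thesis using poly_roots_finite by simp
qed

text \<open>
  A generic point is built one coordinate at a time: countably many polynomials have to be
  avoided and each excludes finitely many values of the next coordinate.
\<close>

lemma algebraically_independent_point_exists:
  assumes "finite X"
  shows "\<exists>z. \<forall>P :: ('x \<Rightarrow>\<^sub>0 nat) \<Rightarrow>\<^sub>0 rat.
    P \<noteq> 0 \<and> (\<forall>m\<in>Poly_Mapping.keys P. Poly_Mapping.keys m \<subseteq> X) \<longrightarrow> eval_poly P z \<noteq> 0"
  using assms
proof (induction X rule: finite_induct)
  case empty
  have "eval_poly P z \<noteq> 0"
    if "P \<noteq> 0" and "\<forall>m\<in>Poly_Mapping.keys P. Poly_Mapping.keys m \<subseteq> {}"
    for P :: "('x \<Rightarrow>\<^sub>0 nat) \<Rightarrow>\<^sub>0 rat" and z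
  proof -
    have sub: "Poly_Mapping.keys P \<subseteq> {0}"
      using that(2) by (auto simp: in_keys_iff intro!: poly_mapping_eqI)
    with that(1) have "Poly_Mapping.lookup P 0 \<noteq> 0"
      by (metis in_keys_iff poly_mapping_eqI lookup_zero singletonD subsetD)
    then show ?thesis using eval_poly_superset[OF _ sub] by simp
  qed
  then show ?case by blast
next
  case (insert y X)
  then obtain z where z: "\<And>Q :: ('x \<Rightarrow>\<^sub>0 nat) \<Rightarrow>\<^sub>0 rat. Q \<noteq> 0 \<Longrightarrow>
      \<forall>m\<in>Poly_Mapping.keys Q. Poly_Mapping.keys m \<subseteq> X \<Longrightarrow> eval_poly Q z \<noteq> 0"
    by auto
  define \<P> where "\<P> = {P :: ('x \<Rightarrow>\<^sub>0 nat) \<Rightarrow>\<^sub>0 rat. P \<noteq> 0 \<and>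
      (\<forall>m\<in>Poly_Mapping.keys P. Poly_Mapping.keys m \<subseteq> insert y X)}"
  have "countable \<P>"
    using countable_rational_polynomials[of "insert y X"] insert.hyps
    unfolding \<P>_def by (rule_tac countable_subset) auto
  moreover have "countable {t. eval_poly P (z(y := t)) = 0}" if "P \<in> \<P>" for P
    using finite_bad_values[OF insert.hyps(1,2) _ _ z, of P] that
    by (intro countable_finite) (auto simp: \<P>_def)
  ultimately have "countable (\<Union>P\<in>\<P>. {t. eval_poly P (z(y := t)) = 0})"
    by blast
  then obtain t where "t \<notin> (\<Union>P\<in>\<P>. {t. eval_poly P (z(y := t)) = 0})"
    using uncountable_UNIV_complex by (metis UNIV_eq_I)
  then have "\<forall>P\<in>\<P>. eval_poly P (z(y := t)) \<noteq> 0" by auto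
  then show ?case
    unfolding \<P>_def by (intro exI[of _ "z(y := t)"]) (simp only: mem_Collect_eq Ball_def simp_thms)
qed

lemma generic_generic_config:
  assumes "finite V"
  shows "generic d V (generic_config d V)"
proof -
  obtain z where z: "\<forall>P :: ('a \<times> nat \<Rightarrow>\<^sub>0 nat) \<Rightarrow>\<^sub>0 rat.
    P \<noteq> 0 \<and> (\<forall>m\<in>Poly_Mapping.keys P. Poly_Mapping.keys m \<subseteq> V \<times> {..<d}) \<longrightarrow> eval_poly P z \<noteq> 0"
    using algebraically_independent_point_exists[of "V \<times> {..<d}"] assms by auto
  have "generic d V (curry z)" using z unfolding generic_def curry_def by (simp add: case_prod_eta)
  then show ?thesis unfolding generic_config_def by (rule someI[of "generic d V"])
qed

section \<open>Specialisation of linear independence\<close>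

text \<open>
  Independence of rows is stated for indexed families, because two edges could have equal rows and
  because the index set stays fixed while the configuration varies.
\<close>

definition independent_family :: "'e set \<Rightarrow> ('e \<Rightarrow> 'x \<Rightarrow> complex) \<Rightarrow> bool" where
  "independent_family F r \<longleftrightarrow> (\<forall>c. (\<forall>x. (\<Sum>e\<in>F. c e * r e x) = 0) \<longrightarrow> (\<forall>e\<in>F. c e = 0))"

lemma sum_fun_scale_apply: "(\<Sum>a\<in>A. fun_scale (c a) (f a)) x = (\<Sum>a\<in>A. c a * f a x)"
  by (induction A rule: infinite_finite_induct) (auto simp: fun_scale_def)

lemma independent_family_iff:
  assumes "finite F"
  shows "independent_family F r \<longleftrightarrow> inj_on r F \<and> cfun.independent (r ` F)"
proof
  assume *: "independent_family F r"
  have inj: "inj_on r F"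
  proof (rule inj_onI, rule ccontr)
    fix e f assume ef: "e \<in> F" "f \<in> F" "r e = r f" "e \<noteq> f"
    define c :: "'a \<Rightarrow> complex" where "c = (\<lambda>g. if g = e then 1 else if g = f then -1 else 0)"
    have "(\<Sum>g\<in>F. c g * r g x) = 0" for x
    proof -
      have "(\<Sum>g\<in>F. c g * r g x) = (\<Sum>g\<in>{e, f}. c g * r g x)"
        by (rule sum.mono_neutral_right) (use assms ef in \<open>auto simp: c_def\<close>)
      also have "\<dots> = 0" using ef by (simp add: c_def)
      finally show ?thesis .
    qed
    with * have "c e = 0" using ef unfolding independent_family_def by blast
    then show False by (simp add: c_def)
  qed
  have "u w = 0" if "(\<Sum>w\<in>r ` F. fun_scale (u w) w) = 0" "w \<in> r ` F" for u w
  proof -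
    have "(\<Sum>e\<in>F. fun_scale (u (r e)) (r e)) = 0"
      using that(1) inj by (simp add: sum.reindex)
    then have "\<forall>x. (\<Sum>e\<in>F. u (r e) * r e x) = 0"
      by (metis sum_fun_scale_apply zero_fun_apply)
    with * have "\<forall>e\<in>F. u (r e) = 0"
      unfolding independent_family_def by (elim allE[of _ "u \<circ> r"]) simp
    with that(2) show ?thesis by auto
  qed
  then have "cfun.independent (r ` F)"
    using assms by (subst cfun.dependent_finite) auto
  with inj show "inj_on r F \<and> cfun.independent (r ` F)" by blast
next
  assume *: "inj_on r F \<and> cfun.independent (r ` F)"
  show "independent_family F r"
    unfolding independent_family_def
  proof (intro allI impI)
    fix c assume c: "\<forall>x. (\<Sum>e\<in>F. c e * r e x) = 0"
    define u where "u = c \<circ> inv_into F r"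
    have u: "u (r e) = c e" if "e \<in> F" for e
      using * that by (simp add: u_def)
    have "(\<Sum>w\<in>r ` F. fun_scale (u w) w) = (\<Sum>e\<in>F. fun_scale (c e) (r e))"
      using * u by (simp add: sum.reindex)
    also have "\<dots> = 0" using c by (simp add: fun_eq_iff sum_fun_scale_apply)
    finally have "\<forall>w\<in>r ` F. u w = 0"
      using * cfun.independentD[of "r ` F" "r ` F" u] assms by blast
    with u show "\<forall>e\<in>F. c e = 0" by auto
  qed
qed

text \<open>
  One step of fraction-free Gaussian elimination: a row with a nonzero pivot entry clears the pivot
  column, and only subtraction and multiplication of entries are used.
\<close>

lemma independent_family_pivot:
  assumes "finite F" "e \<notin> F" and pivot: "r e x0 \<noteq> 0"
  shows "independent_family (insert e F) r \<longleftrightarrow>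
    independent_family F (\<lambda>f x. r e x0 * r f x - r f x0 * r e x)" (is "_ \<longleftrightarrow> independent_family F ?r")
proof -
  have combination: "(\<Sum>f\<in>F. c f * ?r f x) =
      r e x0 * (\<Sum>f\<in>F. c f * r f x) - (\<Sum>f\<in>F. c f * r f x0) * r e x" for c x
    by (simp add: sum_distrib_right sum_distrib_left sum_subtractf algebra_simps)
  show ?thesis
  proof
    assume ind: "independent_family (insert e F) r"
    show "independent_family F ?r"
      unfolding independent_family_def
    proof (intro allI impI)
      fix c assume c: "\<forall>x. (\<Sum>f\<in>F. c f * ?r f x) = 0"
      \<comment> \<open>The coefficient of \<open>e\<close> collects the multiples of the pivot row that were subtracted.\<close>
      define c' where "c' = (\<lambda>f. if f = e then - (\<Sum>f\<in>F. c f * r f x0) else c f * r e x0)"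
      have "(\<Sum>f\<in>insert e F. c' f * r f x) = 0" for x
      proof -
        have "(\<Sum>f\<in>F. c' f * r f x) = (\<Sum>f\<in>F. r e x0 * (c f * r f x))"
          by (rule sum.cong) (use assms(2) in \<open>auto simp: c'_def\<close>)
        then have "(\<Sum>f\<in>insert e F. c' f * r f x) = (\<Sum>f\<in>F. c f * ?r f x)"
          unfolding combination using assms(1,2) by (simp add: c'_def sum_distrib_left)
        with c show ?thesis by simp
      qed
      then have c': "\<forall>f\<in>insert e F. c' f = 0"
        using ind unfolding independent_family_def by blast
      show "\<forall>f\<in>F. c f = 0"
      proof
        fix f assume f: "f \<in> F"
        then have "c f * r e x0 = 0" using c' assms(2) unfolding c'_def by (metis insertCI)
        with pivot show "c f = 0" by simp
      qed
    qed
  next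
    assume ind: "independent_family F ?r"
    show "independent_family (insert e F) r"
      unfolding independent_family_def
    proof (intro allI impI)
      fix c assume "\<forall>x. (\<Sum>f\<in>insert e F. c f * r f x) = 0"
      then have c: "c e * r e x = - (\<Sum>f\<in>F. c f * r f x)" for x
        using assms(1,2) by (simp add: eq_neg_iff_add_eq_0)
      have "(\<Sum>f\<in>F. c f * ?r f x) = 0" for x
        unfolding combination using c[of x] c[of x0] by algebra
      then have 0: "\<forall>f\<in>F. c f = 0" using ind unfolding independent_family_def by blast
      then have "c e = 0" using c[of x0] pivot by simp
      with 0 show "\<forall>f\<in>insert e F. c f = 0" by simp
    qed
  qed
qed

text \<open>
  Fraction-free Gaussian elimination takes place in the ring \<open>R\<close> of possible matrix entries, and
  a pivot that is nonzero at \<open>s0\<close> stays nonzero at \<open>s\<close>.  So elimination guided by \<open>s0\<close> also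
  certifies independence at \<open>s\<close>; no determinants are involved.
\<close>

lemma independent_family_specialise:
  fixes r :: "'e \<Rightarrow> 'x \<Rightarrow> 's \<Rightarrow> complex"
  assumes "finite F"
    and mult: "\<And>f g. f \<in> R \<Longrightarrow> g \<in> R \<Longrightarrow> (\<lambda>s. f s * g s) \<in> R"
    and diff: "\<And>f g. f \<in> R \<Longrightarrow> g \<in> R \<Longrightarrow> (\<lambda>s. f s - g s) \<in> R"
    and nonzero: "\<And>f. f \<in> R \<Longrightarrow> f s0 \<noteq> 0 \<Longrightarrow> f s \<noteq> 0"
    and "\<And>e x. e \<in> F \<Longrightarrow> r e x \<in> R"
    and "independent_family F (\<lambda>e x. r e x s0)"
  shows "independent_family F (\<lambda>e x. r e x s)"
  using assms(1,5,6)
proof (induction F arbitrary: r rule: finite_induct)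
  case empty
  then show ?case by (simp add: independent_family_def)
next
  case (insert e F)
  obtain x0 where x0: "r e x0 s0 \<noteq> 0"
  proof (rule ccontr)
    assume "\<not> thesis"
    with that have zero_row: "\<forall>x. r e x s0 = 0" by blast
    define c where "c = (\<lambda>f. if f = e then 1 else 0 :: complex)"
    have "(\<Sum>f\<in>insert e F. c f * r f x s0) = 0" for x
      using zero_row by (intro sum.neutral) (auto simp: c_def)
    then have "c e = 0"
      using insert.prems(2) unfolding independent_family_def by blast
    then show False by (simp add: c_def)
  qed
  define r' where "r' = (\<lambda>f x s. r e x0 s * r f x s - r f x0 s * r e x s)"
  have "independent_family F (\<lambda>f x. r' f x s0)"
    using independent_family_pivot[of F e "\<lambda>e x. r e x s0"] insert.hyps x0 insert.prems(2)
    unfolding r'_def by simp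
  moreover have "r' f x \<in> R" if "f \<in> F" for f x
    unfolding r'_def using that insert.prems(1) by (intro diff mult) auto
  ultimately have "independent_family F (\<lambda>f x. r' f x s)" using insert.IH[of r'] by blast
  moreover have "r e x0 s \<noteq> 0" using nonzero x0 insert.prems(1) by blast
  ultimately show ?case
    using independent_family_pivot[of F e "\<lambda>e x. r e x s"] insert.hyps unfolding r'_def by simp
qed

text \<open>
  A polynomial that is nonzero somewhere is nonzero at a generic point, so specialisation applies
  with an arbitrary test point \<open>z0\<close>.
\<close>

lemma generic_independent_family:
  fixes r :: "'e \<Rightarrow> 'x \<Rightarrow> ('a \<times> nat \<Rightarrow> complex) \<Rightarrow> complex"
  assumes "generic d V p" "finite F"
    and "\<And>e x. e \<in> F \<Longrightarrow> r e x \<in> rational_polynomials (V \<times> {..<d})"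
    and "independent_family F (\<lambda>e x. r e x z0)"
  shows "independent_family F (\<lambda>e x. r e x (case_prod p))"
  by (rule independent_family_specialise[where R = "rational_polynomials (V \<times> {..<d})" and ?s0.0 = z0])
     (use assms in \<open>auto intro: rational_polynomials_mult rational_polynomials_diff dest: generic_nonzero\<close>)

text \<open>
  At most \<open>d + 1\<close> generic points are affinely independent, because the origin and the standard
  basis vectors are, and affine independence is independence of the rows of homogeneous coordinates.
\<close>

lemma generic_affinely_independent:
  assumes gen: "generic d W p" and fin: "finite W" and card: "card W \<le> d + 1"
    and b_sum: "(\<Sum>x\<in>W. b x) = 0"
    and b_dep: "\<And>i. i < d \<Longrightarrow> (\<Sum>x\<in>W. b x * p x i) = 0"
    and "x \<in> W"
  shows "b x = (0 :: complex)"
proof -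
  \<comment> \<open>The row of \<open>x\<close> lists the homogeneous coordinates of the point \<open>p x\<close>.\<close>
  define r :: "'a \<Rightarrow> nat option \<Rightarrow> ('a \<times> nat \<Rightarrow> complex) \<Rightarrow> complex"
    where "r = (\<lambda>x j z. case j of None \<Rightarrow> 1 | Some i \<Rightarrow> if i < d then z (x, i) else 0)"
  have r_poly: "r x j \<in> rational_polynomials (W \<times> {..<d})" if "x \<in> W" for x j
  proof (cases j)
    case None
    then show ?thesis using rational_polynomials_const[of 1] by (simp add: r_def)
  next
    case (Some i)
    then show ?thesis
      using that rational_polynomials_const[of 0] rational_polynomials_var[of "(x, i)" "W \<times> {..<d}"]
      by (cases "i < d") (auto simp: r_def)
  qed
  obtain h where h: "inj_on h W" "h ` W \<subseteq> {..d}"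
    using card fin card_le_inj[of W "{..d}"] by auto
  define z0 where "z0 = (\<lambda>(x, i). if h x = i then 1 else 0 :: complex)"
  \<comment> \<open>\<open>z0\<close> places the points at distinct standard basis vectors, or at the origin if \<open>h x = d\<close>.\<close>
  have "independent_family W (\<lambda>x j. r x j z0)"
    unfolding independent_family_def
  proof (intro allI impI)
    fix c assume c: "\<forall>j. (\<Sum>x\<in>W. c x * r x j z0) = 0"
    have low: "c x = 0" if x: "x \<in> W" "h x < d" for x
    proof -
      have "0 = (\<Sum>y\<in>W. c y * r y (Some (h x)) z0)" using c by simp
      also have "\<dots> = (\<Sum>y\<in>W. if y = x then c x else 0)"
        by (rule sum.cong) (use x h(1) in \<open>auto simp: r_def z0_def inj_on_eq_iff\<close>)
      finally show ?thesis using fin x by simp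
    qed
    show "\<forall>x\<in>W. c x = 0"
    proof
      fix x assume x: "x \<in> W"
      show "c x = 0"
      proof (cases "h x < d")
        case False
        have others: "c y = 0" if "y \<in> W - {x}" for y
        proof -
          have "h y \<noteq> h x" "h y \<le> d" "h x \<le> d" using that x h by (auto simp: inj_on_eq_iff)
          with False have "h y < d" by linarith
          with low that show ?thesis by blast
        qed
        have "0 = (\<Sum>y\<in>W. c y)" using spec[OF c, of None] by (simp add: r_def)
        also have "\<dots> = c x" using fin x others by (simp add: sum.remove)
        finally show ?thesis by simp
      qed (use low x in blast)
    qed
  qed
  then have "independent_family W (\<lambda>x j. r x j (case_prod p))"
    by (intro generic_independent_family[OF gen fin]) (use r_poly in auto)
  moreover have "(\<Sum>x\<in>W. b x * r x j (case_prod p)) = 0" for j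
    using b_sum b_dep by (cases j; cases "the j < d") (auto simp: r_def)
  ultimately show ?thesis using \<open>x \<in> W\<close> unfolding independent_family_def by blast
qed

section \<open>Rows of the rigidity matrix and stresses\<close>

lemma jacobian_row_doubleton:
  "jacobian_row d G p {a, b} (x, i) =
     (if x \<in> verts G \<and> i < d
      then 2 * (p a i - p b i) * ((if x = a then 1 else 0) - (if x = b then 1 else 0)) else 0)"
proof (cases "x \<in> verts G \<and> i < d")
  case True
  define q where "q = (\<lambda>z. p(x := (p x)(i := z)))"
  define q' where "q' = (\<lambda>y j. if y = x \<and> j = i then 1 else 0 :: complex)"
  have q: "((\<lambda>z. q z y j) has_field_derivative q' y j) (at z)" for y j z
    by (cases "y = x"; cases "j = i") (auto simp: q_def q'_def intro!: derivative_eq_intros)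
  have "((\<lambda>z. \<Sum>j<d. (q z a j - q z b j)\<^sup>2) has_field_derivative
      (\<Sum>j<d. 2 * (q (p x i) a j - q (p x i) b j) * (q' a j - q' b j))) (at (p x i))"
    by (intro DERIV_sum) (auto intro!: derivative_eq_intros q)
  moreover have "q (p x i) = p" by (simp add: q_def)
  moreover have "(\<Sum>j<d. 2 * (p a j - p b j) * (q' a j - q' b j)) =
      (\<Sum>j<d. if j = i then 2 * (p a i - p b i) * (q' a i - q' b i) else 0)"
    by (rule sum.cong) (auto simp: q'_def)
  ultimately have "((\<lambda>z. edge_measure d (q z) {a, b}) has_field_derivative
      2 * (p a i - p b i) * (q' a i - q' b i)) (at (p x i))"
    using True by (simp add: edge_measure_doubleton)
  then show ?thesis
    using True unfolding jacobian_row_def q_def by (auto simp: DERIV_imp_deriv q'_def)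
qed (auto simp: jacobian_row_def)

lemma jacobian_row_polynomial:
  assumes "card e = 2" "e \<subseteq> verts G"
  shows "(\<lambda>z. jacobian_row d G (curry z) e xi) \<in> rational_polynomials (verts G \<times> {..<d})"
proof -
  obtain a b where e: "e = {a, b}" using assms(1) by (auto simp: card_2_iff)
  obtain x i where xi: "xi = (x, i)" by (cases xi)
  show ?thesis
  proof (cases "x \<in> verts G \<and> i < d")
    case True
    define k :: rat where "k = 2 * ((if x = a then 1 else 0) - (if x = b then 1 else 0))"
    have "(\<lambda>z. of_rat k * (z (a, i) - z (b, i))) \<in> rational_polynomials (verts G \<times> {..<d})"
      using True assms(2) e
      by (intro rational_polynomials_mult rational_polynomials_const rational_polynomials_diff
          rational_polynomials_var) auto
    also have "(\<lambda>z. of_rat k * (z (a, i) - z (b, i))) = (\<lambda>z. jacobian_row d G (curry z) e xi)"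
      using True by (auto simp: e xi jacobian_row_doubleton k_def fun_eq_iff)
    finally show ?thesis .
  next
    case False
    then have "(\<lambda>z. jacobian_row d G (curry z) e xi) = (\<lambda>z. of_rat 0)"
      by (auto simp: e xi jacobian_row_doubleton)
    then show ?thesis by (simp only: rational_polynomials_const)
  qed
qed

definition pairs_on :: "'a set \<Rightarrow> 'a set set \<Rightarrow> bool" where
  "pairs_on V E \<longleftrightarrow> finite V \<and> (\<forall>e\<in>E. e \<subseteq> V \<and> card e = 2)"

lemma pairs_on_finite: "pairs_on V E \<Longrightarrow> finite E"
  unfolding pairs_on_def by (meson PowI finite_Pow_iff finite_subset subsetI)

text \<open>
  Here \<open>p0\<close> is arbitrary: independence at any configuration forces independence at the generic
  ones.
\<close>

lemma generic_rows_independent: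
  assumes "pairs_on (verts G) F" "generic d (verts G) p"
    and "independent_family F (jacobian_row d G p0)"
  shows "independent_family F (jacobian_row d G p)"
  using generic_independent_family[OF assms(2) pairs_on_finite[OF assms(1)],
      of "\<lambda>e xi z. jacobian_row d G (curry z) e xi" "case_prod p0"]
    assms(1,3) jacobian_row_polynomial[of _ G d]
  by (auto simp: pairs_on_def)

text \<open>
  Up to sign, the component at \<open>x\<close> of the Laplacian matrix with weights \<open>\<omega>\<close> applied to \<open>q\<close>; a
  stress of a framework is a weight whose Laplacian annihilates every coordinate of the
  configuration.
\<close>

definition laplacian :: "'a set \<Rightarrow> ('a set \<Rightarrow> complex) \<Rightarrow> ('a \<Rightarrow> complex) \<Rightarrow> 'a \<Rightarrow> complex" where
  "laplacian V \<omega> q x = (\<Sum>y\<in>V. \<omega> {y, x} * (q y - q x))"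

lemma laplacian_symmetric:
  "(\<Sum>x\<in>V. laplacian V \<omega> q x * r x) = (\<Sum>x\<in>V. laplacian V \<omega> r x * q x)"
proof -
  have "(\<Sum>x\<in>V. laplacian V \<omega> q x * r x) - (\<Sum>x\<in>V. laplacian V \<omega> r x * q x) =
      (\<Sum>x\<in>V. \<Sum>y\<in>V. \<omega> {y, x} * (q y * r x)) - (\<Sum>x\<in>V. \<Sum>y\<in>V. \<omega> {y, x} * (r y * q x))"
    unfolding laplacian_def sum_distrib_right sum_subtractf[symmetric]
    by (intro sum.cong) (auto simp: algebra_simps)
  also have "(\<Sum>x\<in>V. \<Sum>y\<in>V. \<omega> {y, x} * (r y * q x)) = (\<Sum>x\<in>V. \<Sum>y\<in>V. \<omega> {y, x} * (q y * r x))"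
    by (subst sum.swap) (simp add: insert_commute mult.commute)
  finally show ?thesis by simp
qed

lemma laplacian_add_scaled:
  "laplacian V (\<lambda>e. \<omega> e + c * \<tau> e) q x = laplacian V \<omega> q x + c * laplacian V \<tau> q x"
  unfolding laplacian_def sum_distrib_left sum.distrib[symmetric]
  by (intro sum.cong) (auto simp: algebra_simps)

lemma laplacian_superset:
  assumes "finite W" "V \<subseteq> W" "\<And>e. \<not> e \<subseteq> V \<Longrightarrow> \<omega> e = 0"
  shows "laplacian W \<omega> q x = (if x \<in> V then laplacian V \<omega> q x else 0)"
proof (cases "x \<in> V")
  case True
  have "laplacian W \<omega> q x = laplacian V \<omega> q x"
    unfolding laplacian_def by (rule sum.mono_neutral_right) (use assms in auto)
  with True show ?thesis by simp
next
  case False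
  then show ?thesis using assms(3) by (simp add: laplacian_def)
qed

lemma stresses_iff_laplacian:
  assumes "pairs_on (verts G) (edges G)"
  shows "\<omega> \<in> stresses d G p \<longleftrightarrow> (\<forall>e. e \<notin> edges G \<longrightarrow> \<omega> e = 0) \<and>
    (\<forall>x\<in>verts G. \<forall>i<d. laplacian (verts G) \<omega> (\<lambda>y. p y i) x = 0)"
proof -
  have "(\<Sum>y | {y, x} \<in> edges G. \<omega> {y, x} * (p y i - p x i)) = laplacian (verts G) \<omega> (\<lambda>y. p y i) x"
    if "\<forall>e. e \<notin> edges G \<longrightarrow> \<omega> e = 0" for x i
    unfolding laplacian_def
    by (rule sum.mono_neutral_left) (use assms that in \<open>auto simp: pairs_on_def\<close>)
  then show ?thesis by (auto simp: stresses_def)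
qed

text \<open>
  A linear dependence of rows of the rigidity matrix is the same thing as a stress, up to the
  factor that comes from differentiating a square.
\<close>

lemma sum_jacobian_rows:
  assumes "pairs_on (verts G) E" "\<And>e. e \<notin> E \<Longrightarrow> \<omega> e = 0" "x \<in> verts G" "i < d"
  shows "(\<Sum>e\<in>E. \<omega> e * jacobian_row d G p e (x, i)) = - 2 * laplacian (verts G) \<omega> (\<lambda>y. p y i) x"
proof -
  have V: "finite (verts G)" and E: "\<And>e. e \<in> E \<Longrightarrow> e \<subseteq> verts G \<and> card e = 2"
    using assms(1) by (auto simp: pairs_on_def)
  have inj: "inj_on (\<lambda>y. {y, x}) (verts G)" by (auto simp: inj_on_def doubleton_eq_iff)
  have star: "{e \<in> E. x \<in> e} = (\<lambda>y. {y, x}) ` {y \<in> verts G. {y, x} \<in> E}"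
  proof (intro equalityI subsetI)
    fix e assume e: "e \<in> {e \<in> E. x \<in> e}"
    then obtain a b where ab: "e = {a, b}" "a \<noteq> b" using E[of e] by (auto simp: card_2_iff)
    with e have "x = a \<or> x = b" by auto
    then obtain y where "e = {y, x}" using ab by blast
    with e E[of e] show "e \<in> (\<lambda>y. {y, x}) ` {y \<in> verts G. {y, x} \<in> E}" by auto
  qed auto
  have "(\<Sum>e\<in>E. \<omega> e * jacobian_row d G p e (x, i)) =
      (\<Sum>e\<in>{e \<in> E. x \<in> e}. \<omega> e * jacobian_row d G p e (x, i))"
  proof (rule sum.mono_neutral_right)
    show "\<forall>e\<in>E - {e \<in> E. x \<in> e}. \<omega> e * jacobian_row d G p e (x, i) = 0"
    proof
      fix e assume e: "e \<in> E - {e \<in> E. x \<in> e}"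
      then obtain a b where "e = {a, b}" using E[of e] by (auto simp: card_2_iff)
      with e show "\<omega> e * jacobian_row d G p e (x, i) = 0" by (auto simp: jacobian_row_doubleton)
    qed
  qed (use pairs_on_finite[OF assms(1)] in auto)
  also have "\<dots> = (\<Sum>y\<in>{y \<in> verts G. {y, x} \<in> E}. \<omega> {y, x} * jacobian_row d G p {y, x} (x, i))"
    unfolding star by (subst sum.reindex) (auto intro: inj_on_subset[OF inj])
  also have "\<dots> = (\<Sum>y\<in>verts G. \<omega> {y, x} * jacobian_row d G p {y, x} (x, i))"
    by (rule sum.mono_neutral_left) (use V assms(2) in auto)
  also have "\<dots> = (\<Sum>y\<in>verts G. - 2 * (\<omega> {y, x} * (p y i - p x i)))"
    using assms(3,4) by (intro sum.cong) (auto simp: jacobian_row_doubleton algebra_simps)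
  finally show ?thesis by (simp add: laplacian_def sum_distrib_left)
qed

lemma sum_jacobian_rows_eq_0_iff:
  assumes "pairs_on (verts G) E" "\<And>e. e \<notin> E \<Longrightarrow> \<omega> e = 0"
  shows "(\<forall>xi. (\<Sum>e\<in>E. \<omega> e * jacobian_row d G p e xi) = 0) \<longleftrightarrow>
    (\<forall>x\<in>verts G. \<forall>i<d. laplacian (verts G) \<omega> (\<lambda>y. p y i) x = 0)"
proof -
  have "(\<Sum>e\<in>E. \<omega> e * jacobian_row d G p e (x, i)) =
     (if x \<in> verts G \<and> i < d then - 2 * laplacian (verts G) \<omega> (\<lambda>y. p y i) x else 0)" for x i
    using sum_jacobian_rows[OF assms, where x = x and i = i and d = d and p = p] by (auto simp: jacobian_row_def)
  then show ?thesis by auto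
qed

section \<open>Linked pairs\<close>

abbreviation generic_row :: "nat \<Rightarrow> 'a ugraph \<Rightarrow> 'a set \<Rightarrow> 'a \<times> nat \<Rightarrow> complex" where
  "generic_row d G \<equiv> jacobian_row d G (generic_config d (verts G))"

lemma rigidity_indep_iff:
  assumes "finite (edges G)"
  shows "rigidity_indep d G F \<longleftrightarrow> F \<subseteq> edges G \<and> independent_family F (generic_row d G)"
  using independent_family_iff[OF finite_subset[OF _ assms]]
  by (auto simp: rigidity_indep_def Let_def)

lemma rigidity_rank_attained:
  assumes "finite (edges G)"
  obtains F where "rigidity_indep d G F" "card F = rigidity_rank d G"
proof -
  have "finite {F. rigidity_indep d G F}"
    by (rule finite_subset[of _ "Pow (edges G)"]) (use assms in \<open>auto simp: rigidity_indep_def\<close>)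
  moreover have "rigidity_indep d G {}"
    by (simp add: rigidity_indep_def Let_def cfun.independent_empty)
  ultimately have "rigidity_rank d G \<in> card ` {F. rigidity_indep d G F}"
    unfolding rigidity_rank_def by (intro Max_in) auto
  with that show ?thesis by auto
qed

lemma card_le_rigidity_rank:
  assumes "finite (edges G)" "rigidity_indep d G F"
  shows "card F \<le> rigidity_rank d G"
proof -
  have "finite {F. rigidity_indep d G F}"
    by (rule finite_subset[of _ "Pow (edges G)"]) (use assms in \<open>auto simp: rigidity_indep_def\<close>)
  then show ?thesis using assms(2) unfolding rigidity_rank_def by (intro Max_ge) auto
qed

text \<open>
  A linked pair is given by ranks at configurations chosen separately for each graph; the stress is
  needed at a common configuration, and the transfer happens at the level of independent rows.
  If \<open>uv\<close> does not increase the rank, then adding it to a maximum independent set of edges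
  produces a dependence, in which \<open>uv\<close> takes part.
\<close>

lemma linked_imp_stress:
  assumes G: "pairs_on (verts G) (edges G)" and uv: "u \<in> verts G" "v \<in> verts G" "u \<noteq> v"
    and new: "{u, v} \<notin> edges G" and linked: "rigidity_linked d G u v"
    and gen: "generic d (verts G) p"
  obtains \<omega> where "\<omega> \<in> stresses d (add_edge G u v) p" "\<omega> {u, v} = 1"
proof -
  let ?H = "add_edge G u v"
  have H: "pairs_on (verts G) (edges ?H)" and [simp]: "verts ?H = verts G"
    and EH: "edges ?H = insert {u, v} (edges G)"
    using G uv by (auto simp: pairs_on_def add_edge_def)
  obtain F where F: "rigidity_indep d G F" "card F = rigidity_rank d G"
    using rigidity_rank_attained[OF pairs_on_finite[OF G]] .
  have FE: "F \<subseteq> edges G" "independent_family F (generic_row d G)"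
    using F(1) by (auto simp: rigidity_indep_iff pairs_on_finite[OF G])
  let ?F = "insert {u, v} F"
  have pairs_F: "pairs_on (verts G) ?F" "pairs_on (verts G) F"
    using FE(1) H by (auto simp: pairs_on_def add_edge_def)
  have row_H: "jacobian_row d ?H q = jacobian_row d G q" for q
    by (simp add: jacobian_row_def fun_eq_iff)
  have "\<not> independent_family ?F (generic_row d G)"
  proof
    assume "independent_family ?F (generic_row d G)"
    then have "rigidity_indep d ?H ?F"
      using FE(1) by (subst rigidity_indep_iff[OF pairs_on_finite[OF H]])
        (auto simp: row_H EH)
    then have "card ?F \<le> rigidity_rank d ?H"
      by (rule card_le_rigidity_rank[OF pairs_on_finite[OF H]])
    moreover have "card ?F = Suc (card F)"
      using FE(1) new pairs_on_finite[OF pairs_F(2)] by (subst card_insert_disjoint) auto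
    ultimately show False using F(2) linked by (simp add: rigidity_linked_def)
  qed
  moreover have gen0: "generic d (verts G) (generic_config d (verts G))"
    using G by (intro generic_generic_config) (simp add: pairs_on_def)
  ultimately have dep: "\<not> independent_family ?F (jacobian_row d G p)"
    using generic_rows_independent[OF pairs_F(1)] by blast
  have ind: "independent_family F (jacobian_row d G p)"
    using generic_rows_independent[OF pairs_F(2) gen] FE(2) by blast
  obtain c where c: "\<forall>xi. (\<Sum>e\<in>?F. c e * jacobian_row d G p e xi) = 0" "\<exists>e\<in>?F. c e \<noteq> 0"
    using dep unfolding independent_family_def by blast
  have c_uv: "c {u, v} \<noteq> 0"
  proof
    assume 0: "c {u, v} = 0"
    with c(1) have "\<forall>xi. (\<Sum>e\<in>F. c e * jacobian_row d G p e xi) = 0"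
      using FE(1) new pairs_on_finite[OF pairs_F(2)] by (subst (asm) sum.insert) auto
    with ind have "\<forall>e\<in>F. c e = 0" unfolding independent_family_def by blast
    with 0 c(2) show False by blast
  qed
  define \<omega> where "\<omega> = (\<lambda>e. if e \<in> ?F then c e / c {u, v} else 0)"
  have "(\<Sum>e\<in>?F. \<omega> e * jacobian_row d G p e xi) = 0" for xi
  proof -
    have "(\<Sum>e\<in>?F. \<omega> e * jacobian_row d G p e xi) =
        (\<Sum>e\<in>?F. c e * jacobian_row d G p e xi) / c {u, v}"
      unfolding sum_divide_distrib by (rule sum.cong) (auto simp: \<omega>_def)
    then show ?thesis using c(1) by simp
  qed
  then have "\<forall>x\<in>verts G. \<forall>i<d. laplacian (verts G) \<omega> (\<lambda>y. p y i) x = 0"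
    using sum_jacobian_rows_eq_0_iff[OF pairs_F(1), where \<omega> = \<omega> and d = d and p = p] by (auto simp: \<omega>_def)
  then have "\<omega> \<in> stresses d ?H p"
    using FE(1) H by (subst stresses_iff_laplacian) (auto simp: \<omega>_def add_edge_def)
  moreover have "\<omega> {u, v} = 1" using c_uv by (simp add: \<omega>_def)
  ultimately show thesis using that by blast
qed

text \<open>
  Such a stress writes the row of \<open>uv\<close> as a combination of the rows
  of \<open>G\<close>, so a basis chosen among the latter still bounds the rank after adding \<open>uv\<close>.
\<close>

lemma stress_imp_linked:
  assumes G: "pairs_on (verts G) (edges G)" and uv: "u \<in> verts G" "v \<in> verts G" "u \<noteq> v"
    and \<omega>: "\<omega> \<in> stresses d (add_edge G u v) (generic_config d (verts G))" "\<omega> {u, v} = 1"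
  shows "rigidity_linked d G u v"
proof (cases "{u, v} \<in> edges G")
  case True
  then have "add_edge G u v = G" by (simp add: add_edge_def insert_absorb)
  then show ?thesis by (simp add: rigidity_linked_def)
next
  case False
  let ?H = "add_edge G u v"
  have H: "pairs_on (verts G) (edges ?H)" and VH [simp]: "verts ?H = verts G"
    and EH: "edges ?H = insert {u, v} (edges G)"
    using G uv by (auto simp: pairs_on_def add_edge_def)
  note fin = pairs_on_finite[OF G] pairs_on_finite[OF H]
  let ?row = "generic_row d G"
  have row_H: "generic_row d ?H = ?row"
    by (simp add: jacobian_row_def fun_eq_iff)
  have "\<forall>xi. (\<Sum>e\<in>edges ?H. \<omega> e * ?row e xi) = 0"
    using \<omega>(1) H stresses_iff_laplacian[of ?H \<omega> d] sum_jacobian_rows_eq_0_iff[OF H, where \<omega> = \<omega>] by auto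
  then have "?row {u, v} xi = (\<Sum>e\<in>edges G. - \<omega> e * ?row e xi)" for xi
    using False fin \<omega>(2) by (cases xi) (simp add: EH sum_negf eq_neg_iff_add_eq_0)
  then have row_uv: "?row {u, v} = (\<Sum>e\<in>edges G. fun_scale (- \<omega> e) (?row e))"
    by (intro ext) (simp only: sum_fun_scale_apply)
  have "?row {u, v} \<in> cfun.span (?row ` edges G)"
    unfolding row_uv by (intro cfun.span_sum cfun.span_scale cfun.span_base imageI)
  then have span_H: "?row ` edges ?H \<subseteq> cfun.span (?row ` edges G)"
    by (auto simp: EH intro: cfun.span_base)
  obtain B where B: "B \<subseteq> ?row ` edges G" "cfun.independent B" "?row ` edges G \<subseteq> cfun.span B"
    using cfun.maximal_independent_subset[of "?row ` edges G"] by metis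
  then obtain F where F: "F \<subseteq> edges G" "inj_on ?row F" "B = ?row ` F"
    using subset_image_inj[of B ?row "edges G"] by blast
  then have "rigidity_indep d G F"
    using B(2) by (simp add: rigidity_indep_def Let_def)
  then have F_le: "card F \<le> rigidity_rank d G" by (rule card_le_rigidity_rank[OF fin(1)])
  obtain F' where F': "rigidity_indep d ?H F'" "card F' = rigidity_rank d ?H"
    using rigidity_rank_attained[OF fin(2)] .
  have "card F' = card (?row ` F')"
    using F'(1) row_H by (simp add: rigidity_indep_def Let_def card_image)
  also have "\<dots> \<le> card B"
  proof (rule conjunct2[OF cfun.independent_span_bound])
    show "finite B" using F fin(1) finite_subset by auto
    show "cfun.independent (?row ` F')" using F'(1) row_H by (simp add: rigidity_indep_def Let_def)
    have "?row ` F' \<subseteq> ?row ` edges ?H" using F'(1) by (auto simp: rigidity_indep_def)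
    also have "\<dots> \<subseteq> cfun.span (?row ` edges G)" by (rule span_H)
    also have "\<dots> \<subseteq> cfun.span B" using B(3) by (rule cfun.span_minimal) (rule cfun.subspace_span)
    finally show "?row ` F' \<subseteq> cfun.span B" .
  qed
  also have "card B = card F" using F by (simp add: card_image)
  finally have "rigidity_rank d ?H \<le> rigidity_rank d G" using F_le F'(2) by simp
  moreover obtain F0 where F0: "rigidity_indep d G F0" "card F0 = rigidity_rank d G"
    using rigidity_rank_attained[OF fin(1)] .
  moreover have "rigidity_indep d ?H F0"
    using F0(1) row_H by (auto simp: rigidity_indep_def Let_def EH)
  then have "card F0 \<le> rigidity_rank d ?H" by (rule card_le_rigidity_rank[OF fin(2)])
  ultimately show ?thesis by (simp add: rigidity_linked_def)
qed

section \<open>Gluing along few vertices\<close>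

lemma stress_extend:
  assumes "pairs_on (verts H) (edges H)" "verts H \<subseteq> V" "edges H \<subseteq> E" "pairs_on V E"
    and "\<omega> \<in> stresses d H p"
  shows "\<omega> \<in> stresses d (V, E) p"
proof -
  have \<omega>: "\<And>e. e \<notin> edges H \<Longrightarrow> \<omega> e = 0"
    "\<And>x i. x \<in> verts H \<Longrightarrow> i < d \<Longrightarrow> laplacian (verts H) \<omega> (\<lambda>y. p y i) x = 0"
    using assms(5) stresses_iff_laplacian[OF assms(1), of \<omega> d p] by auto
  have "laplacian V \<omega> (\<lambda>y. p y i) x = 0" if "i < d" for x i
  proof (subst laplacian_superset[of V "verts H"])
    show "finite V" using assms(4) by (simp add: pairs_on_def)
    show "\<omega> e = 0" if "\<not> e \<subseteq> verts H" for e using \<omega>(1) assms(1) that by (auto simp: pairs_on_def)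
  qed (use assms(2) \<omega>(2) that in auto)
  then show ?thesis
    using \<omega>(1) assms(3,4) by (subst stresses_iff_laplacian) auto
qed

lemma stress_kernel_iff_laplacian:
  assumes "pairs_on (verts G) (edges G)"
  shows "q \<in> stress_kernel d G p \<longleftrightarrow> (\<forall>x. x \<notin> verts G \<longrightarrow> q x = 0) \<and>
    (\<forall>\<omega>\<in>stresses d G p. \<forall>x\<in>verts G. laplacian (verts G) \<omega> q x = 0)"
  using stresses_iff_laplacian[OF assms] by (auto simp: stress_kernel_def)

text \<open>
  The common image of \<open>q\<close> under the two Laplacians is supported on the common vertices.  By symmetry
  of the Laplacian of \<open>\<omega>1\<close> it is orthogonal to the constants and to the coordinates of \<open>p\<close>, which
  that Laplacian annihilates.  So it is an affine dependence of at most \<open>d + 1\<close> generic points.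
\<close>

lemma laplacian_kernel_eq_0:
  assumes V: "finite V1" "finite V2" and W: "card (V1 \<inter> V2) \<le> d + 1"
    and gen: "generic d (V1 \<union> V2) p"
    and supp1: "\<And>e. \<not> e \<subseteq> V1 \<Longrightarrow> \<omega>1 e = 0" and supp2: "\<And>e. \<not> e \<subseteq> V2 \<Longrightarrow> \<omega>2 e = 0"
    and stress: "\<And>x i. x \<in> V1 \<union> V2 \<Longrightarrow> i < d \<Longrightarrow> laplacian (V1 \<union> V2) \<omega>1 (\<lambda>y. p y i) x = 0"
    and eq: "\<And>x. x \<in> V1 \<union> V2 \<Longrightarrow> laplacian (V1 \<union> V2) \<omega>1 q x = laplacian (V1 \<union> V2) \<omega>2 q x"
    and x: "x \<in> V1 \<union> V2"
  shows "laplacian (V1 \<union> V2) \<omega>1 q x = 0"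
proof -
  let ?V = "V1 \<union> V2"
  define b where "b = laplacian ?V \<omega>1 q"
  have off: "b y = 0" if "y \<in> ?V" "y \<notin> V1 \<inter> V2" for y
    using that laplacian_superset[of ?V V1 \<omega>1 q y, OF _ _ supp1]
      laplacian_superset[of ?V V2 \<omega>2 q y, OF _ _ supp2] V eq[of y]
    unfolding b_def by (auto split: if_splits)
  have restrict: "(\<Sum>y\<in>V1 \<inter> V2. b y * r y) = (\<Sum>y\<in>?V. b y * r y)" for r
    by (rule sum.mono_neutral_left) (use V off in auto)
  have "(\<Sum>y\<in>?V. b y * 1) = (\<Sum>y\<in>?V. laplacian ?V \<omega>1 (\<lambda>_. 1) y * q y)"
    unfolding b_def by (rule laplacian_symmetric)
  then have b_sum: "(\<Sum>y\<in>V1 \<inter> V2. b y) = 0"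
    using restrict[of "\<lambda>_. 1"] by (simp add: laplacian_def)
  have b_dep: "(\<Sum>y\<in>V1 \<inter> V2. b y * p y i) = 0" if "i < d" for i
  proof -
    have "(\<Sum>y\<in>?V. b y * p y i) = (\<Sum>y\<in>?V. laplacian ?V \<omega>1 (\<lambda>y. p y i) y * q y)"
      unfolding b_def by (rule laplacian_symmetric)
    also have "\<dots> = 0" using stress that by (intro sum.neutral) simp
    finally show ?thesis using restrict[of "\<lambda>y. p y i"] by simp
  qed
  have "b x = 0"
  proof (cases "x \<in> V1 \<inter> V2")
    case True
    have "generic d (V1 \<inter> V2) p" using gen by (rule generic_subset) auto
    then show ?thesis
      by (rule generic_affinely_independent[where b = b])
         (use V W b_sum b_dep True in auto)
  qed (use off x in blast)
  then show ?thesis by (simp add: b_def)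
qed

theorem theorem4p12:
  fixes d :: nat and G1 G2 :: "'a ugraph" and u v :: 'a
  assumes "d \<ge> 1"
    and "simple_graph G1" and "simple_graph G2"
    and "card (verts G1 \<inter> verts G2) \<le> d + 1"
    and "u \<in> verts G1 \<inter> verts G2" and "v \<in> verts G1 \<inter> verts G2" and "u \<noteq> v"
    and "rigidity_linked d G1 u v" and "rigidity_linked d G2 u v"
  shows "stress_linked d (graph_union G1 G2) u v"
proof (cases "{u, v} \<in> edges (graph_union G1 G2)")
  case True
  then have "add_edge (graph_union G1 G2) u v = graph_union G1 G2"
    by (simp add: add_edge_def insert_absorb)
  then show ?thesis by (simp add: stress_linked_def rigidity_linked_def)
next
  case False
  define V where "V = verts G1 \<union> verts G2"
  define E where "E = edges G1 \<union> edges G2"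
  define p where "p = generic_config d V"
  let ?G = "(V, E)" and ?H = "(V, insert {u, v} E)"
  have union: "graph_union G1 G2 = ?G" by (simp add: graph_union_def V_def E_def)
  have add: "add_edge ?G u v = ?H" by (simp add: add_edge_def)
  have uv: "u \<in> V" "v \<in> V" and new: "{u, v} \<notin> E" "{u, v} \<notin> edges G1" "{u, v} \<notin> edges G2"
    using assms(5,6) False by (auto simp: V_def E_def graph_union_def)
  have G1: "pairs_on (verts G1) (edges G1)" and G2: "pairs_on (verts G2) (edges G2)"
    using assms(2,3) by (auto simp: simple_graph_def pairs_on_def)
  then have G: "pairs_on V E" by (auto simp: pairs_on_def V_def E_def)
  then have H: "pairs_on V (insert {u, v} E)" using uv \<open>u \<noteq> v\<close> by (simp add: pairs_on_def)
  have finV: "finite (verts G1)" "finite (verts G2)" "finite V"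
    using G1 G2 G by (auto simp: pairs_on_def)
  have gen: "generic d V p" unfolding p_def by (rule generic_generic_config[OF finV(3)])
  have gen1: "generic d (verts G1) p" and gen2: "generic d (verts G2) p"
    using gen by (auto simp: V_def intro: generic_subset)
  obtain \<omega>1 where \<omega>1: "\<omega>1 \<in> stresses d (add_edge G1 u v) p" "\<omega>1 {u, v} = 1"
    using linked_imp_stress[OF G1 _ _ \<open>u \<noteq> v\<close> new(2) assms(8) gen1] assms(5,6) by auto
  obtain \<omega>2 where \<omega>2: "\<omega>2 \<in> stresses d (add_edge G2 u v) p" "\<omega>2 {u, v} = 1"
    using linked_imp_stress[OF G2 _ _ \<open>u \<noteq> v\<close> new(3) assms(9) gen2] assms(5,6) by auto
  have add1: "pairs_on (verts G1) (insert {u, v} (edges G1))"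
    and add2: "pairs_on (verts G2) (insert {u, v} (edges G2))"
    using G1 G2 assms(5-7) by (auto simp: pairs_on_def)
  have \<omega>H: "\<omega>1 \<in> stresses d ?H p" "\<omega>2 \<in> stresses d ?H p"
    using stress_extend[of "add_edge G1 u v" V "insert {u, v} E" \<omega>1 d p]
      stress_extend[of "add_edge G2 u v" V "insert {u, v} E" \<omega>2 d p] \<omega>1(1) \<omega>2(1) add1 add2 H
    by (auto simp: add_edge_def V_def E_def)
  have supp1: "\<omega>1 e = 0" if "\<not> e \<subseteq> verts G1" for e
  proof -
    have "e \<notin> insert {u, v} (edges G1)" using add1 that by (auto simp: pairs_on_def)
    then show ?thesis using \<omega>1(1) by (simp add: stresses_def add_edge_def)
  qed
  have supp2: "\<omega>2 e = 0" if "\<not> e \<subseteq> verts G2" for e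
  proof -
    have "e \<notin> insert {u, v} (edges G2)" using add2 that by (auto simp: pairs_on_def)
    then show ?thesis using \<omega>2(1) by (simp add: stresses_def add_edge_def)
  qed
  note stress_G = stresses_iff_laplacian[of ?G, simplified, OF G]
    and stress_H = stresses_iff_laplacian[of ?H, simplified, OF H]
    and kernel_G = stress_kernel_iff_laplacian[of ?G, simplified, OF G]
    and kernel_H = stress_kernel_iff_laplacian[of ?H, simplified, OF H]

  have "rigidity_linked d ?G u v"
    by (rule stress_imp_linked[of _ _ _ \<omega>1]) (use G uv \<open>u \<noteq> v\<close> \<omega>H(1) \<omega>1(2) in \<open>auto simp: add p_def\<close>)
  moreover have "stress_kernel d ?H p = stress_kernel d ?G p"
  proof (intro equalityI subsetI)
    fix q assume "q \<in> stress_kernel d ?H p"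
    then show "q \<in> stress_kernel d ?G p"
      unfolding kernel_G kernel_H using stress_G stress_H by auto
  next
    fix q assume q: "q \<in> stress_kernel d ?G p"
    \<comment> \<open>A multiple of \<open>\<omega>1\<close> removes the coefficient of \<open>uv\<close> from any stress of the larger graph.\<close>
    have cancel: "laplacian V \<tau> q x = \<tau> {u, v} * laplacian V \<omega>1 q x"
      if "\<tau> \<in> stresses d ?H p" "x \<in> V" for \<tau> x
    proof -
      note \<tau> = that(1)[unfolded stress_H] and \<omega>1_H = \<omega>H(1)[unfolded stress_H]
      have "\<tau> e + (- \<tau> {u, v}) * \<omega>1 e = 0" if "e \<notin> E" for e
        using \<tau> \<omega>1_H \<omega>1(2) that by (cases "e = {u, v}") auto
      then have "(\<lambda>e. \<tau> e + (- \<tau> {u, v}) * \<omega>1 e) \<in> stresses d ?G p"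
        unfolding stress_G laplacian_add_scaled using \<tau> \<omega>1_H by auto
      then have "laplacian V (\<lambda>e. \<tau> e + (- \<tau> {u, v}) * \<omega>1 e) q x = 0"
        using q that(2) unfolding kernel_G by blast
      then show ?thesis unfolding laplacian_add_scaled by simp
    qed
    have "laplacian V \<omega>1 q x = 0" if "x \<in> V" for x
      unfolding V_def
    proof (rule laplacian_kernel_eq_0[where p = p and d = d and ?\<omega>2.0 = \<omega>2])
      show "laplacian (verts G1 \<union> verts G2) \<omega>1 q y = laplacian (verts G1 \<union> verts G2) \<omega>2 q y"
        if "y \<in> verts G1 \<union> verts G2" for y
        using cancel[OF \<omega>H(2), of y] that \<omega>2(2) by (simp add: V_def)
    qed (use finV assms(4) gen supp1 supp2 \<omega>H(1)[unfolded stress_H] that in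
        \<open>auto simp: V_def\<close>)
    with cancel q show "q \<in> stress_kernel d ?H p" unfolding kernel_G kernel_H by auto
  qed
  then have "stress_kernel_dim d ?H = stress_kernel_dim d ?G"
    by (simp add: stress_kernel_dim_def p_def)
  ultimately show ?thesis by (simp add: stress_linked_def union add)
qed

end
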